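(* Let $\mathcal{E}$ be the class of Kalmár elementary functions. Then $$\langle 2x,\ x\bmod y,\ 2^x\rangle\subsetneqq\mathcal{E}.$$
   Context: $\mathbb{N}$ is the set of non-negative integers. An ($r$-ary, $r\ge 1$) operation on $\mathbb{N}$ is a function $\mathbb{N}^r\to\mathbb{N}$. Truncated subtraction is $x \mathbin{\dot-} y:=\max(x-y,0)$. Conventions: $\lfloor x/0\rfloor:=0$, and $x\bmod y:=x \mathbin{\dot-} y\lfloor x/y\rfloor$, so that $x\bmod 0=x$. A set $S$ of operations on $\mathbb{N}$ is closed under substitution if, whenever $f\in S$ is $r$-ary and $g_1,\dots,g_r\in S$ are $n$-ary, the operation $\vec x\mapsto f(g_1(\vec x),\dots,g_r(\vec x))$ is in $S$. For a set $\mathcal{B}$ of operations on $\mathbb{N}$, $\langle\mathcal{B}\rangle$ denotes the closure under substitution of $\mathcal{B}\cup C\cup P$, where $C$ is the set of all constant operations on $\mathbb{N}$ (of every arity) and $P$ is the set of all projections $(x_1,\dots,x_n)\mapsto x_i$. Here $2x$ and $2^x$ denote unary operations and $x\bmod y$ a binary operation. The Kalmár elementary functions, forming the class $\mathcal{E}$, are the elements of the smallest set of operations on $\mathbb{N}$ that contains the constants, the projections, the addition, and the truncated subtraction, and that is closed under substitution, bounded summation ($(\vec x,y)\mapsto\sum_{z<y}f(\vec x,z)$), and bounded multiplication ($(\vec x,y)\mapsto\prod_{z<y}f(\vec x,z)$). *)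

theory Defs
  imports Main "HOL-Library.FuncSet"
begin

text \<open>
  An \<open>r\<close>-ary operation on the natural numbers is the pair of its arity \<open>r\<close> and a function on
  lists that is \<open>undefined\<close> outside the lists of length \<open>r\<close>. With this normalization, HOL equality
  of such pairs is equality of arities together with equality of the functions from
  \<open>r\<close>-tuples to numbers, so sets of operations can be compared by plain inclusion.
\<close>

type_synonym operation = "nat \<times> (nat list \<Rightarrow> nat)"

definition mk_op :: "nat \<Rightarrow> (nat list \<Rightarrow> nat) \<Rightarrow> operation" where
  "mk_op r f = (r, restrict f {xs. length xs = r})"

abbreviation arity :: "operation \<Rightarrow> nat" where
  "arity \<equiv> fst"

abbreviation app :: "operation \<Rightarrow> nat list \<Rightarrow> nat" where
  "app \<equiv> snd"

definition operations :: "operation set" where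
  "operations = {mk_op r f | r f. r \<ge> 1}"

definition constants :: "operation set" where
  "constants = {mk_op n (\<lambda>xs. c) | n c. n \<ge> 1}"

definition projections :: "operation set" where
  "projections = {mk_op n (\<lambda>xs. xs ! i) | n i. i < n}"

definition subst_op :: "nat \<Rightarrow> operation \<Rightarrow> operation list \<Rightarrow> operation" where
  "subst_op n f gs = mk_op n (\<lambda>xs. app f (map (\<lambda>g. app g xs) gs))"

text \<open>
  In the next two definitions the last argument is the bound \<open>y\<close> and
  the preceding arguments, possibly none, are the parameters.
\<close>

definition bounded_sum :: "operation \<Rightarrow> operation" where
  "bounded_sum f = mk_op (arity f) (\<lambda>xs. \<Sum>z<last xs. app f (butlast xs @ [z]))"

definition bounded_prod :: "operation \<Rightarrow> operation" where
  "bounded_prod f = mk_op (arity f) (\<lambda>xs. \<Prod>z<last xs. app f (butlast xs @ [z]))"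

text \<open>Meaningful for \<open>B \<subseteq> operations\<close>; see \<open>subst_closure_subset_operations\<close> below.\<close>

inductive_set subst_closure :: "operation set \<Rightarrow> operation set" for B where
  base: "f \<in> B \<Longrightarrow> f \<in> subst_closure B"
| const: "f \<in> constants \<Longrightarrow> f \<in> subst_closure B"
| proj: "f \<in> projections \<Longrightarrow> f \<in> subst_closure B"
| subst: "f \<in> subst_closure B \<Longrightarrow> length gs = arity f \<Longrightarrow>
    (\<forall>g\<in>set gs. g \<in> subst_closure B \<and> arity g = n) \<Longrightarrow> subst_op n f gs \<in> subst_closure B"

definition add_op :: operation where
  "add_op = mk_op 2 (\<lambda>xs. xs ! 0 + xs ! 1)"

text \<open>Subtraction on \<^typ>\<open>nat\<close> is truncated.\<close>

definition monus_op :: operation where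
  "monus_op = mk_op 2 (\<lambda>xs. xs ! 0 - xs ! 1)"

inductive_set kalmar_elementary :: "operation set" where
  const: "f \<in> constants \<Longrightarrow> f \<in> kalmar_elementary"
| proj: "f \<in> projections \<Longrightarrow> f \<in> kalmar_elementary"
| add: "add_op \<in> kalmar_elementary"
| monus: "monus_op \<in> kalmar_elementary"
| subst: "f \<in> kalmar_elementary \<Longrightarrow> length gs = arity f \<Longrightarrow>
    (\<forall>g\<in>set gs. g \<in> kalmar_elementary \<and> arity g = n) \<Longrightarrow> subst_op n f gs \<in> kalmar_elementary"
| sum: "f \<in> kalmar_elementary \<Longrightarrow> bounded_sum f \<in> kalmar_elementary"
| prod: "f \<in> kalmar_elementary \<Longrightarrow> bounded_prod f \<in> kalmar_elementary"

definition double_op :: operation where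
  "double_op = mk_op 1 (\<lambda>xs. 2 * xs ! 0)"

text \<open>On \<^typ>\<open>nat\<close> we have \<open>x div 0 = 0\<close> and \<open>x mod 0 = x\<close>.\<close>

definition mod_op :: operation where
  "mod_op = mk_op 2 (\<lambda>xs. xs ! 0 mod xs ! 1)"

definition exp2_op :: operation where
  "exp2_op = mk_op 1 (\<lambda>xs. 2 ^ (xs ! 0))"

lemma arity_mk_op [simp]: "arity (mk_op r f) = r"
  by (simp add: mk_op_def)

lemma mk_op_in_operations [simp]: "mk_op r f \<in> operations \<longleftrightarrow> r \<ge> 1"
  by (auto simp: operations_def mk_op_def)

lemma arity_operations: "f \<in> operations \<Longrightarrow> arity f \<ge> 1"
  by (auto simp: operations_def)

lemma subst_op_in_operations:
  assumes "f \<in> operations" "length gs = arity f" "\<forall>g\<in>set gs. g \<in> operations \<and> arity g = n"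
  shows "subst_op n f gs \<in> operations"
proof -
  have "1 \<le> length gs"
    unfolding assms(2) by (rule arity_operations[OF assms(1)])
  then have "hd gs \<in> set gs"
    by (intro hd_in_set) (auto simp del: One_nat_def)
  then have "hd gs \<in> operations" "arity (hd gs) = n"
    using assms(3) by (simp_all only: Ball_def)
  then have "1 \<le> n"
    using arity_operations[of "hd gs"] by (simp only:)
  then show ?thesis
    by (simp only: subst_op_def mk_op_in_operations)
qed

lemma constants_subset_operations: "constants \<subseteq> operations"
  unfolding constants_def operations_def by blast

lemma projections_subset_operations: "projections \<subseteq> operations"
proof
  fix f assume "f \<in> projections"
  then obtain n i where "f = mk_op n (\<lambda>xs. xs ! i)" "i < n"
    unfolding projections_def by blast
  then show "f \<in> operations"
    by (simp only: mk_op_in_operations)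
qed

lemma subst_closure_subset_operations:
  assumes "B \<subseteq> operations"
  shows "subst_closure B \<subseteq> operations"
proof
  fix f assume "f \<in> subst_closure B"
  then show "f \<in> operations"
  proof induction
    case (base f)
    with assms show ?case by (rule subsetD)
  next
    case (const f)
    with constants_subset_operations show ?case by (rule subsetD)
  next
    case (proj f)
    with projections_subset_operations show ?case by (rule subsetD)
  next
    case (subst f gs n)
    from subst.IH(2) have "\<forall>g\<in>set gs. g \<in> operations \<and> arity g = n"
      by blast
    with subst.IH(1) subst.hyps(2) show ?case by (rule subst_op_in_operations)
  qed
qed

lemma kalmar_elementary_subset_operations: "kalmar_elementary \<subseteq> operations"
proof
  fix f assume "f \<in> kalmar_elementary"
  then show "f \<in> operations"
  proof induction
    case (const f)
    with constants_subset_operations show ?case by (rule subsetD)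
  next
    case (proj f)
    with projections_subset_operations show ?case by (rule subsetD)
  next
    case add
    show ?case by (simp add: add_op_def)
  next
    case monus
    show ?case by (simp add: monus_op_def)
  next
    case (subst f gs n)
    from subst.IH(2) have "\<forall>g\<in>set gs. g \<in> operations \<and> arity g = n"
      by blast
    with subst.IH(1) subst.hyps(2) show ?case by (rule subst_op_in_operations)
  next
    case (sum f)
    then show ?case
      unfolding bounded_sum_def mk_op_in_operations by (intro arity_operations)
  next
    case (prod f)
    then show ?case
      unfolding bounded_prod_def mk_op_in_operations by (intro arity_operations)
  qed
qed

end

theory Submission imports Defs begin

text \<open>
  Following the first argument of \<open>mod\<close>, every operation in the substitution closure of
  \<open>2x\<close>, \<open>x mod y\<close>, \<open>2\<^sup>x\<close> is bounded by a monotone function of one of its arguments;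
  the addition is not, as that argument may be \<open>0\<close> while the other one is arbitrarily large.
\<close>

lemma app_mk_op [simp]: "length xs = r \<Longrightarrow> app (mk_op r f) xs = f xs"
  by (simp add: mk_op_def)

text \<open>Outside the lists of length \<open>r\<close> both operations are
  \<open>undefined\<close>, so agreement on the lists of length \<open>r\<close> gives HOL
  equality.\<close>

lemma mk_op_cong: "(\<And>xs. length xs = r \<Longrightarrow> f xs = g xs) \<Longrightarrow> mk_op r f = mk_op r g"
  by (auto simp: mk_op_def restrict_def)

lemma kalmar_elementary_const: "n \<ge> 1 \<Longrightarrow> mk_op n (\<lambda>xs. c) \<in> kalmar_elementary"
  by (rule kalmar_elementary.const) (auto simp: constants_def)

lemma kalmar_elementary_proj: "i < n \<Longrightarrow> mk_op n (\<lambda>xs. xs ! i) \<in> kalmar_elementary"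
  by (rule kalmar_elementary.proj) (auto simp: projections_def)

text \<open>Recasts closure under substitution for plain functions on lists, so that membership can
  be derived by following the structure of a term.\<close>

lemma kalmar_elementary_subst:
  assumes f: "mk_op (length gs) f \<in> kalmar_elementary"
    and gs: "\<And>g. g \<in> set gs \<Longrightarrow> mk_op n g \<in> kalmar_elementary"
  shows "mk_op n (\<lambda>xs. f (map (\<lambda>g. g xs) gs)) \<in> kalmar_elementary"
proof -
  have "subst_op n (mk_op (length gs) f) (map (mk_op n) gs) \<in> kalmar_elementary"
    using f gs by (intro kalmar_elementary.subst) auto
  also have "subst_op n (mk_op (length gs) f) (map (mk_op n) gs) =
      mk_op n (\<lambda>xs. f (map (\<lambda>g. g xs) gs))"
    unfolding subst_op_def by (rule mk_op_cong) (simp add: o_def)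
  finally show ?thesis .
qed

lemma kalmar_elementary_subst2:
  assumes "mk_op 2 (\<lambda>xs. f (xs ! 0) (xs ! 1)) \<in> kalmar_elementary"
    and "mk_op n g \<in> kalmar_elementary" "mk_op n h \<in> kalmar_elementary"
  shows "mk_op n (\<lambda>xs. f (g xs) (h xs)) \<in> kalmar_elementary"
  using kalmar_elementary_subst[of "[g, h]" "\<lambda>xs. f (xs ! 0) (xs ! 1)" n] assms
  by (auto simp: numeral_2_eq_2)

lemma kalmar_elementary_add:
  assumes "mk_op n g \<in> kalmar_elementary" "mk_op n h \<in> kalmar_elementary"
  shows "mk_op n (\<lambda>xs. g xs + h xs) \<in> kalmar_elementary"
  using kalmar_elementary.add assms unfolding add_op_def by (rule kalmar_elementary_subst2)

lemma kalmar_elementary_diff: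
  assumes "mk_op n g \<in> kalmar_elementary" "mk_op n h \<in> kalmar_elementary"
  shows "mk_op n (\<lambda>xs. g xs - h xs) \<in> kalmar_elementary"
  using kalmar_elementary.monus assms unfolding monus_op_def by (rule kalmar_elementary_subst2)

text \<open>Bounded sums and products take their bound from the last argument. Substituting a
  function of the parameters for that argument permits bounds such as \<open>xs ! 0\<close>, where
  the bound is itself a parameter.\<close>

lemma kalmar_elementary_bounded_arg:
  assumes "mk_op (Suc n) (\<lambda>xs. F (last xs) (butlast xs)) \<in> kalmar_elementary"
    and "mk_op n b \<in> kalmar_elementary"
  shows "mk_op n (\<lambda>xs. F (b xs) xs) \<in> kalmar_elementary"
proof -
  \<comment> \<open>The projections reproduce \<open>xs\<close> and \<open>b\<close> supplies the
    bound: the inner values form \<open>xs @ [b xs]\<close>.\<close>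
  let ?gs = "map (\<lambda>i xs. xs ! i) [0..<n] @ [b]"
  have "mk_op n (\<lambda>xs. (\<lambda>xs. F (last xs) (butlast xs)) (map (\<lambda>g. g xs) ?gs)) \<in> kalmar_elementary"
    using assms by (intro kalmar_elementary_subst) (auto intro: kalmar_elementary_proj)
  also have "mk_op n (\<lambda>xs. (\<lambda>xs. F (last xs) (butlast xs)) (map (\<lambda>g. g xs) ?gs)) =
      mk_op n (\<lambda>xs. F (b xs) xs)"
    by (rule mk_op_cong) (auto simp: o_def map_nth butlast_append)
  finally show ?thesis .
qed

lemma kalmar_elementary_sum:
  assumes f: "mk_op (Suc n) f \<in> kalmar_elementary" and b: "mk_op n b \<in> kalmar_elementary"
  shows "mk_op n (\<lambda>xs. \<Sum>z<b xs. f (xs @ [z])) \<in> kalmar_elementary"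
proof -
  \<comment> \<open>If \<open>xs\<close> has length \<open>Suc n\<close>, so has
    \<open>butlast xs @ [z]\<close>; hence \<open>app\<close> of the normalized operation agrees
    with \<open>f\<close> there.\<close>
  have "bounded_sum (mk_op (Suc n) f) =
      mk_op (Suc n) (\<lambda>xs. \<Sum>z<last xs. f (butlast xs @ [z]))"
    unfolding bounded_sum_def arity_mk_op by (rule mk_op_cong) simp
  with kalmar_elementary.sum[OF f] b show ?thesis
    by (intro kalmar_elementary_bounded_arg[where F = "\<lambda>y xs. \<Sum>z<y. f (xs @ [z])"]) simp_all
qed

lemma kalmar_elementary_prod:
  assumes f: "mk_op (Suc n) f \<in> kalmar_elementary" and b: "mk_op n b \<in> kalmar_elementary"
  shows "mk_op n (\<lambda>xs. \<Prod>z<b xs. f (xs @ [z])) \<in> kalmar_elementary"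
proof -
  have "bounded_prod (mk_op (Suc n) f) =
      mk_op (Suc n) (\<lambda>xs. \<Prod>z<last xs. f (butlast xs @ [z]))"
    unfolding bounded_prod_def arity_mk_op by (rule mk_op_cong) simp
  with kalmar_elementary.prod[OF f] b show ?thesis
    by (intro kalmar_elementary_bounded_arg[where F = "\<lambda>y xs. \<Prod>z<y. f (xs @ [z])"]) simp_all
qed

lemma kalmar_elementary_mult:
  assumes "mk_op n g \<in> kalmar_elementary" "mk_op n h \<in> kalmar_elementary"
  shows "mk_op n (\<lambda>xs. g xs * h xs) \<in> kalmar_elementary"
proof -
  \<comment> \<open>Multiplication as repeated addition: the summand ignores
    \<open>z\<close>.\<close>
  have "mk_op 2 (\<lambda>xs. \<Sum>z<xs ! 1. (xs @ [z]) ! 0) \<in> kalmar_elementary"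
    by (rule kalmar_elementary_sum[where f = "\<lambda>xs. xs ! 0"])
      (simp_all add: kalmar_elementary_proj)
  also have "mk_op 2 (\<lambda>xs. \<Sum>z<xs ! 1. (xs @ [z]) ! 0) = mk_op 2 (\<lambda>xs. xs ! 0 * xs ! 1)"
    by (rule mk_op_cong) (simp add: nth_append)
  finally show ?thesis
    using assms by (rule kalmar_elementary_subst2)
qed

lemma double_op_kalmar_elementary: "double_op \<in> kalmar_elementary"
  unfolding double_op_def mult_2
  by (intro kalmar_elementary_add kalmar_elementary_proj) simp_all

lemma exp2_op_kalmar_elementary: "exp2_op \<in> kalmar_elementary"
proof -
  have "mk_op 1 (\<lambda>xs. \<Prod>z<xs ! 0. 2) \<in> kalmar_elementary"
    by (rule kalmar_elementary_prod[where f = "\<lambda>xs. 2"])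
      (simp_all add: kalmar_elementary_proj kalmar_elementary_const)
  then show ?thesis
    by (simp add: exp2_op_def)
qed

text \<open>
  The sum counts the positive multiples of \<open>y\<close> up to \<open>x\<close>. For \<open>y = 0\<close> it is \<open>x\<close> rather than
  \<open>x div 0 = 0\<close>, but then the factor \<open>y\<close> makes it irrelevant.
\<close>

lemma mod_eq_diff_sum: "x mod y = x - y * (\<Sum>z<x. 1 - ((z + 1) * y - x))" for x y :: nat
proof (cases "y = 0")
  case False
  have "(\<Sum>z<x. 1 - ((z + 1) * y - x)) = (\<Sum>z<x. of_bool (z < x div y))"
  \<comment> \<open>Index \<open>z\<close> stands for the multiple \<open>(z + 1) * y\<close>.
    Truncation makes the inner difference 0 exactly when this multiple is at most \<open>x\<close>,
    and \<open>1 - _\<close> turns that into an indicator.\<close>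
  proof (rule sum.cong)
    fix z
    have "(z + 1) * y \<le> x \<longleftrightarrow> z < x div y"
      using False less_eq_div_iff_mult_less_eq[of y "z + 1" x] by auto
    then show "1 - ((z + 1) * y - x) = of_bool (z < x div y)"
      by (cases "z < x div y") auto
  qed simp
  also have "\<dots> = card ({..<x} \<inter> {..<x div y})"
    by (simp add: sum_of_bool_eq lessThan_def)
  \<comment> \<open>As \<open>x div y \<le> x\<close>, stopping the sum at \<open>x\<close> misses
    no multiple.\<close>
  also have "{..<x} \<inter> {..<x div y} = {..<x div y}"
    by (rule Int_absorb1) simp
  finally show ?thesis
    by (simp add: minus_mult_div_eq_mod)
qed simp

lemma mod_op_kalmar_elementary: "mod_op \<in> kalmar_elementary"
proof -
  \<comment> \<open>Positions 0 and 1 hold \<open>x\<close> and \<open>y\<close>; position 2 holds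
    the summation index that is appended to them.\<close>
  let ?f = "\<lambda>xs. 1 - ((xs ! 2 + 1) * xs ! 1 - xs ! 0)"
  have f: "mk_op (Suc 2) ?f \<in> kalmar_elementary"
    by (intro kalmar_elementary_diff kalmar_elementary_mult kalmar_elementary_add
        kalmar_elementary_proj kalmar_elementary_const) simp_all
  have "mk_op 2 (\<lambda>xs. xs ! 0 - xs ! 1 * (\<Sum>z<xs ! 0. ?f (xs @ [z]))) \<in> kalmar_elementary"
    by (intro kalmar_elementary_diff kalmar_elementary_mult kalmar_elementary_proj
        kalmar_elementary_sum[OF f]) simp_all
  also have "mk_op 2 (\<lambda>xs. xs ! 0 - xs ! 1 * (\<Sum>z<xs ! 0. ?f (xs @ [z]))) = mod_op"
    unfolding mod_op_def by (rule mk_op_cong) (simp add: mod_eq_diff_sum nth_append)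
  finally show ?thesis .
qed

lemma subst_closure_subset_kalmar_elementary:
  assumes "B \<subseteq> kalmar_elementary"
  shows "subst_closure B \<subseteq> kalmar_elementary"
proof
  fix f assume "f \<in> subst_closure B"
  then show "f \<in> kalmar_elementary"
    by induction (use assms in \<open>auto intro: kalmar_elementary.intros\<close>)
qed

text \<open>The index \<open>i\<close> is fixed before \<open>xs\<close>, so one argument controls
  the operation everywhere. Monotonicity of \<open>h\<close> lets such bounds be composed.\<close>

definition one_arg_bounded :: "operation \<Rightarrow> bool" where
  "one_arg_bounded f \<longleftrightarrow>
    (\<exists>i<arity f. \<exists>h. mono h \<and> (\<forall>xs. length xs = arity f \<longrightarrow> app f xs \<le> h (xs ! i)))"

lemma one_arg_boundedI:
  assumes "i < n" "mono h" "\<And>xs. length xs = n \<Longrightarrow> f xs \<le> h (xs ! i)"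
  shows "one_arg_bounded (mk_op n f)"
  using assms unfolding one_arg_bounded_def by auto

text \<open>If argument \<open>i\<close> controls \<open>f\<close> with bound \<open>h\<close>, and
  argument \<open>j\<close> controls \<open>gs ! i\<close> with bound \<open>k\<close>, then
  argument \<open>j\<close> controls the composite with bound \<open>h \<circ> k\<close>.\<close>

lemma one_arg_bounded_subst_op:
  assumes f: "one_arg_bounded f" and len: "length gs = arity f"
    and gs: "\<And>g. g \<in> set gs \<Longrightarrow> one_arg_bounded g \<and> arity g = n"
  shows "one_arg_bounded (subst_op n f gs)"
proof -
  obtain i h where i: "i < arity f" and h: "mono h"
    and le: "\<And>xs. length xs = arity f \<Longrightarrow> app f xs \<le> h (xs ! i)"
    using f unfolding one_arg_bounded_def by blast
  have "gs ! i \<in> set gs"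
    using i len by simp
  with gs have "one_arg_bounded (gs ! i)" "arity (gs ! i) = n"
    by blast+
  then obtain j k where j: "j < n" and k: "mono k"
    and le': "\<And>xs. length xs = n \<Longrightarrow> app (gs ! i) xs \<le> k (xs ! j)"
    unfolding one_arg_bounded_def by auto
  show ?thesis
    unfolding subst_op_def
  proof (rule one_arg_boundedI)
    show "j < n" by (fact j)
    show "mono (h \<circ> k)"
      using h k by (auto simp: mono_def)
    fix xs :: "nat list" assume xs: "length xs = n"
    have "app f (map (\<lambda>g. app g xs) gs) \<le> h (app (gs ! i) xs)"
      using le[of "map (\<lambda>g. app g xs) gs"] i len by simp
    also have "\<dots> \<le> h (k (xs ! j))"
      using h le'[OF xs] by (rule monoD)
    finally show "app f (map (\<lambda>g. app g xs) gs) \<le> (h \<circ> k) (xs ! j)"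
      by simp
  qed
qed

lemma one_arg_bounded_subst_closure:
  assumes "f \<in> subst_closure B" and B: "\<And>b. b \<in> B \<Longrightarrow> one_arg_bounded b"
  shows "one_arg_bounded f"
  using assms(1)
proof induction
  case (base f)
  then show ?case by (rule B)
next
  case (const f)
  then obtain n c where "f = mk_op n (\<lambda>xs. c)" "n \<ge> 1"
    unfolding constants_def by blast
  then show ?case
    \<comment> \<open>Index 0 is available because constants have arity at least 1.\<close>
    by (auto intro!: one_arg_boundedI[of 0 _ "\<lambda>x. c"] simp: mono_def)
next
  case (proj f)
  then obtain n i where "f = mk_op n (\<lambda>xs. xs ! i)" "i < n"
    unfolding projections_def by blast
  then show ?case
    by (auto intro!: one_arg_boundedI[of i _ "\<lambda>x. x"] simp: mono_def)
next
  case (subst f gs n)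
  then show ?case
    by (intro one_arg_bounded_subst_op) auto
qed

lemma one_arg_bounded_basis:
  assumes "b \<in> {double_op, mod_op, exp2_op}"
  shows "one_arg_bounded b"
proof -
  have "one_arg_bounded double_op"
    unfolding double_op_def
    by (rule one_arg_boundedI[of 0 _ "\<lambda>x. 2 * x"]) (auto simp: mono_def)
  \<comment> \<open>Here \<open>x mod y \<le> x\<close> for all \<open>y\<close>, including
    \<open>y = 0\<close>, where equality holds.\<close>
  moreover have "one_arg_bounded mod_op"
    unfolding mod_op_def
    by (rule one_arg_boundedI[of 0 _ "\<lambda>x. x"]) (auto simp: mono_def)
  moreover have "one_arg_bounded exp2_op"
    unfolding exp2_op_def
    by (rule one_arg_boundedI[of 0 _ "\<lambda>x. 2 ^ x"]) (auto simp: mono_def)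
  ultimately show ?thesis
    using assms by blast
qed

lemma not_one_arg_bounded_add_op: "\<not> one_arg_bounded add_op"
proof
  assume "one_arg_bounded add_op"
  then obtain i h where i: "i < 2"
    and le: "\<forall>xs :: nat list. length xs = 2 \<longrightarrow> xs ! 0 + xs ! 1 \<le> h (xs ! i)"
    unfolding one_arg_bounded_def add_op_def by auto
  from i consider "i = 0" | "i = 1"
    by linarith
  then show False
  proof cases
    case 1
    \<comment> \<open>With 0 in the controlling position the bound is stuck at \<open>h 0\<close>,
      while the other argument alone exceeds it. The second case is symmetric.\<close>
    then show False using le[rule_format, of "[0, Suc (h 0)]"] by simp
  next
    case 2
    then show False using le[rule_format, of "[Suc (h 0), 0]"] by simp
  qed
qed

theorem theorem12: "subst_closure {double_op, mod_op, exp2_op} \<subset> kalmar_elementary"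
proof
  show "subst_closure {double_op, mod_op, exp2_op} \<subseteq> kalmar_elementary"
    by (rule subst_closure_subset_kalmar_elementary)
      (simp add: double_op_kalmar_elementary mod_op_kalmar_elementary exp2_op_kalmar_elementary)
  have "add_op \<notin> subst_closure {double_op, mod_op, exp2_op}"
    using one_arg_bounded_subst_closure one_arg_bounded_basis not_one_arg_bounded_add_op by blast
  then show "subst_closure {double_op, mod_op, exp2_op} \<noteq> kalmar_elementary"
    using kalmar_elementary.add by blast
qed

end
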